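(* Let $n\ge p>0$ be integers and let $\beta_1,\beta_2>0$. For all $U,\widetilde U\in\mathrm{St}(n,p)$, $$\min\left\{1,\sqrt{\tfrac{\beta_1}{\beta_2}}\right\} d_{\beta_2}(U,\widetilde U)\le d_{\beta_1}(U,\widetilde U)\le \max\left\{1,\sqrt{\tfrac{\beta_1}{\beta_2}}\right\} d_{\beta_2}(U,\widetilde U).$$
   Context: The Stiefel manifold is $\mathrm{St}(n,p)=\{U\in\mathbb{R}^{n\times p} : U^TU=I_p\}$, with tangent space $T_U\mathrm{St}(n,p)=\{\Delta\in\mathbb{R}^{n\times p} : U^T\Delta+\Delta^TU=0\}$. For $\beta>0$ the $\beta$-metric is $\langle\Delta,\widetilde\Delta\rangle_\beta=\mathrm{Tr}\big(\Delta^T(I_n-(1-\beta)UU^T)\widetilde\Delta\big)$ for $\Delta,\widetilde\Delta\in T_U\mathrm{St}(n,p)$, with norm $\|\Delta\|_\beta=\sqrt{\langle\Delta,\Delta\rangle_\beta}$. The length of a continuously differentiable curve $\gamma:[0,1]\to\mathrm{St}(n,p)$ is $l_\beta(\gamma)=\int_0^1\|\dot\gamma(t)\|_\beta\,dt$, and the geodesic $\beta$-distance is $d_\beta(U,\widetilde U)=\inf\{l_\beta(\gamma) : \gamma(0)=U,\ \gamma(1)=\widetilde U\}$, the infimum being over continuously differentiable curves in $\mathrm{St}(n,p)$. When $n=p$ the manifold has two connected components, and distances are considered between points of the same component. *)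

theory Defs
  imports "HOL-Analysis.Analysis"
begin

(* An n x p matrix is an element of real^'p^'n, with n = CARD('n) and p = CARD('p). *)
definition stiefel :: "(real^'p^'n) set" where
  "stiefel = {U. transpose U ** U = mat 1}"

(* The metric is given by its formula for all matrices. It is evaluated only at velocities
   of curves in the Stiefel manifold, which are tangent vectors at the base point. *)
definition beta_inner ::
    "real \<Rightarrow> real^'p^'n \<Rightarrow> real^'p^'n \<Rightarrow> real^'p^'n \<Rightarrow> real" where
  "beta_inner \<beta> U \<Delta> \<Delta>' =
     trace (transpose \<Delta> ** (mat 1 - (1 - \<beta>) *\<^sub>R (U ** transpose U)) ** \<Delta>')"

definition beta_norm :: "real \<Rightarrow> real^'p^'n \<Rightarrow> real^'p^'n \<Rightarrow> real" where
  "beta_norm \<beta> U \<Delta> = sqrt (beta_inner \<beta> U \<Delta> \<Delta>)"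

(* Derivatives at the endpoints of [0,1] are one-sided; values of the function outside
   [0,1] are irrelevant. *)
abbreviation velocity :: "(real \<Rightarrow> real^'p^'n) \<Rightarrow> real \<Rightarrow> real^'p^'n" where
  "velocity \<gamma> t \<equiv> vector_derivative \<gamma> (at t within {0..1})"

definition C1_stiefel_curves ::
    "real^'p^'n \<Rightarrow> real^'p^'n \<Rightarrow> (real \<Rightarrow> real^'p^'n) set" where
  "C1_stiefel_curves U V =
     {\<gamma>. \<gamma> ` {0..1} \<subseteq> stiefel \<and> \<gamma> 0 = U \<and> \<gamma> 1 = V \<and>
          \<gamma> differentiable_on {0..1} \<and> continuous_on {0..1} (velocity \<gamma>)}"

definition beta_length :: "real \<Rightarrow> (real \<Rightarrow> real^'p^'n) \<Rightarrow> real" where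
  "beta_length \<beta> \<gamma> = integral {0..1} (\<lambda>t. beta_norm \<beta> (\<gamma> t) (velocity \<gamma> t))"

(* Extended-real valued, with the infimum of the empty set equal to \<infinity>: for n = p this is
   the distance between points in different components. *)
definition beta_dist :: "real \<Rightarrow> real^'p^'n \<Rightarrow> real^'p^'n \<Rightarrow> ereal" where
  "beta_dist \<beta> U V = (INF \<gamma> \<in> C1_stiefel_curves U V. ereal (beta_length \<beta> \<gamma>))"

end

theory Submission
  imports Defs
begin

text \<open>
  For U in the Stiefel manifold, the squared \<beta>-norm of any matrix D splits as
  (|D|^2 - |U^T D|^2) + \<beta> |U^T D|^2 in terms of the Frobenius norm. Both summands are
  nonnegative, the first because it equals |D - U U^T D|^2. Hence the norms for two parameters
  compare pointwise, and the comparison passes to lengths and to the infimum over curves.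
\<close>

lemma inner_matrix_eq_trace:
  fixes A B :: "real^'m^'n"
  shows "A \<bullet> B = trace (transpose A ** B)"
proof -
  have "A \<bullet> B = (\<Sum>i\<in>UNIV. \<Sum>j\<in>UNIV. A $ i $ j * B $ i $ j)"
    by (simp add: inner_vec_def)
  also have "\<dots> = (\<Sum>j\<in>UNIV. \<Sum>i\<in>UNIV. A $ i $ j * B $ i $ j)"
    by (rule sum.swap)
  finally show ?thesis
    by (simp add: trace_def matrix_matrix_mult_def transpose_def)
qed

lemma inner_transpose_matrix_mult:
  fixes U :: "real^'p^'n" and A :: "real^'m^'n" and B :: "real^'m^'p"
  shows "(transpose U ** A) \<bullet> B = A \<bullet> (U ** B)"
  by (simp add: inner_matrix_eq_trace matrix_transpose_mul matrix_mul_assoc)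

lemma matrix_diff_rdistrib:
  fixes A B :: "real^'m^'n"
  shows "(A - B) ** C = A ** C - B ** C"
  by (simp add: matrix_matrix_mult_def vec_eq_iff left_diff_distrib sum_subtractf)

lemma scaleR_matrix_mult_assoc:
  fixes A :: "real^'m^'n"
  shows "(c *\<^sub>R A) ** B = c *\<^sub>R (A ** B)"
  by (simp add: matrix_matrix_mult_def vec_eq_iff sum_distrib_left mult.assoc)

text \<open>By adjointness for the Frobenius inner product, a left factor \<open>U\<close> moves to
  the other side as its transpose. This trace-free form serves twice: it exposes how the norm
  depends on \<beta>, and it makes continuity along a curve evident.\<close>

lemma beta_inner_eq:
  "beta_inner \<beta> U D D = D \<bullet> D - (1 - \<beta>) * ((transpose U ** D) \<bullet> (transpose U ** D))"
proof -
  have "beta_inner \<beta> U D D = D \<bullet> ((mat 1 - (1 - \<beta>) *\<^sub>R (U ** transpose U)) ** D)"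
    by (simp add: beta_inner_def inner_matrix_eq_trace matrix_mul_assoc)
  also have "(mat 1 - (1 - \<beta>) *\<^sub>R (U ** transpose U)) ** D
      = D - (1 - \<beta>) *\<^sub>R (U ** (transpose U ** D))"
    by (simp add: matrix_diff_rdistrib scaleR_matrix_mult_assoc matrix_mul_assoc)
  finally show ?thesis
    by (simp add: inner_diff_right inner_transpose_matrix_mult)
qed

text \<open>Pythagoras: with orthonormal columns, \<open>U ** transpose U\<close> is the orthogonal
  projection onto the column space of \<open>U\<close>, and the gap between the two sides is the
  squared norm of the residual.\<close>

lemma stiefel_inner_transpose_mult_le:
  assumes "U \<in> stiefel"
  shows "(transpose U ** D) \<bullet> (transpose U ** D) \<le> D \<bullet> D"
proof -
  define B where "B = transpose U ** D"
  have DB: "D \<bullet> (U ** B) = B \<bullet> B"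
    by (simp add: B_def inner_transpose_matrix_mult)
  have "(U ** B) \<bullet> (U ** B) = B \<bullet> (transpose U ** (U ** B))"
    by (metis inner_commute inner_transpose_matrix_mult)
  also have "\<dots> = B \<bullet> B"
    using assms by (simp add: stiefel_def matrix_mul_assoc)
  \<comment> \<open>Expanding the square gives |D|^2 - 2 |B|^2 + |B|^2, since the cross term and |U
    B|^2 both equal |B|^2.\<close>
  finally have "(D - U ** B) \<bullet> (D - U ** B) = D \<bullet> D - B \<bullet> B"
    using DB by (simp add: inner_diff_left inner_diff_right inner_commute)
  then show ?thesis
    unfolding B_def by (metis diff_ge_0_iff_ge inner_ge_zero)
qed

lemma beta_norm_le:
  assumes "U \<in> stiefel" "\<beta>\<^sub>1 > 0" "\<beta>\<^sub>2 > 0"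
  shows "beta_norm \<beta>\<^sub>1 U D \<le> max 1 (sqrt (\<beta>\<^sub>1 / \<beta>\<^sub>2)) * beta_norm \<beta>\<^sub>2 U D"
proof -
  define b where "b = (transpose U ** D) \<bullet> (transpose U ** D)"
  define a where "a = D \<bullet> D - b"
  have nonneg: "a \<ge> 0" "b \<ge> 0"
    using stiefel_inner_transpose_mult_le[OF assms(1)] by (simp_all add: a_def b_def)
  have split: "beta_inner \<beta> U D D = a + \<beta> * b" for \<beta>
    by (simp add: beta_inner_eq a_def b_def algebra_simps)
  \<comment> \<open>The least factor that dominates both coefficients of the split: 1 \<le> m for
    \<open>a\<close>, and \<open>\<beta>\<^sub>1 \<le> m * \<beta>\<^sub>2\<close> for
    \<open>b\<close>.\<close>
  define m where "m = max 1 (\<beta>\<^sub>1 / \<beta>\<^sub>2)"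
  have "a \<le> m * a"
    using nonneg by (simp add: m_def mult_le_cancel_right1)
  moreover have "\<beta>\<^sub>1 \<le> m * \<beta>\<^sub>2"
    using assms by (simp add: m_def flip: pos_divide_le_eq)
  then have "\<beta>\<^sub>1 * b \<le> m * \<beta>\<^sub>2 * b"
    using nonneg by (rule_tac mult_right_mono)
  ultimately have "a + \<beta>\<^sub>1 * b \<le> m * (a + \<beta>\<^sub>2 * b)"
    by (simp add: distrib_left)
  then have "sqrt (a + \<beta>\<^sub>1 * b) \<le> sqrt m * sqrt (a + \<beta>\<^sub>2 * b)"
    by (metis real_sqrt_le_mono real_sqrt_mult)
  \<comment> \<open>The square root is monotone and fixes 1, so it passes through the
    maximum.\<close>
  moreover have "sqrt m = max 1 (sqrt (\<beta>\<^sub>1 / \<beta>\<^sub>2))"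
    by (simp add: m_def max_def)
  ultimately show ?thesis
    by (simp add: beta_norm_def split)
qed

lemma continuous_on_matrix_mult:
  fixes f :: "'a::topological_space \<Rightarrow> real^'m^'n" and g :: "'a \<Rightarrow> real^'k^'m"
  assumes "continuous_on S f" "continuous_on S g"
  shows "continuous_on S (\<lambda>x. f x ** g x)"
  unfolding matrix_matrix_mult_def
  by (intro continuous_intros assms)

lemma continuous_on_transpose:
  fixes f :: "'a::topological_space \<Rightarrow> real^'m^'n"
  assumes "continuous_on S f"
  shows "continuous_on S (\<lambda>x. transpose (f x))"
  unfolding transpose_def
  by (intro continuous_intros assms)

text \<open>Comparing integrals requires integrability of both integrands. Here it follows from
  continuity, which is where the curves being C^1 enters; \<open>sqrt\<close> is continuous on the
  whole real line, so plain composition suffices.\<close>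

lemma beta_norm_velocity_integrable:
  assumes "\<gamma> \<in> C1_stiefel_curves U V"
  shows "(\<lambda>t. beta_norm \<beta> (\<gamma> t) (velocity \<gamma> t)) integrable_on {0..1}"
proof (rule integrable_continuous_interval)
  have "continuous_on {0..1} \<gamma>" "continuous_on {0..1} (velocity \<gamma>)"
    using assms by (auto simp: C1_stiefel_curves_def differentiable_imp_continuous_on)
  then show "continuous_on {0..1} (\<lambda>t. beta_norm \<beta> (\<gamma> t) (velocity \<gamma> t))"
    unfolding beta_norm_def beta_inner_eq
    by (intro continuous_intros continuous_on_matrix_mult continuous_on_transpose)
qed

lemma beta_length_le:
  assumes "\<gamma> \<in> C1_stiefel_curves U V" "\<beta>\<^sub>1 > 0" "\<beta>\<^sub>2 > 0"
  shows "beta_length \<beta>\<^sub>1 \<gamma> \<le> max 1 (sqrt (\<beta>\<^sub>1 / \<beta>\<^sub>2)) * beta_length \<beta>\<^sub>2 \<gamma>"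
proof -
  let ?M = "max 1 (sqrt (\<beta>\<^sub>1 / \<beta>\<^sub>2))"
  have "beta_length \<beta>\<^sub>1 \<gamma>
      \<le> integral {0..1} (\<lambda>t. ?M * beta_norm \<beta>\<^sub>2 (\<gamma> t) (velocity \<gamma> t))"
    unfolding beta_length_def
  proof (rule integral_le)
    fix t :: real assume "t \<in> {0..1}"
    then have "\<gamma> t \<in> stiefel"
      using assms(1) by (auto simp: C1_stiefel_curves_def)
    then show "beta_norm \<beta>\<^sub>1 (\<gamma> t) (velocity \<gamma> t) \<le> ?M * beta_norm \<beta>\<^sub>2 (\<gamma> t) (velocity \<gamma> t)"
      using assms by (intro beta_norm_le)
  qed (intro integrable_on_mult_right beta_norm_velocity_integrable[OF assms(1)])+
  then show ?thesis
    by (simp add: beta_length_def)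
qed

lemma beta_dist_le:
  assumes "\<beta>\<^sub>1 > 0" "\<beta>\<^sub>2 > 0"
  shows "beta_dist \<beta>\<^sub>1 U V \<le> ereal (max 1 (sqrt (\<beta>\<^sub>1 / \<beta>\<^sub>2))) * beta_dist \<beta>\<^sub>2 U V"
proof -
  define M where "M = max 1 (sqrt (\<beta>\<^sub>1 / \<beta>\<^sub>2))"
  have M: "M > 0"
    by (simp add: M_def)
  \<comment> \<open>Dividing by the constant leaves a bare infimum on the right, so it is enough to
    bound each curve. As \<open>M\<close> is positive and finite, the division can be undone even
    when the distances are infinite, so the case without any curve needs no separate
    treatment.\<close>
  have "beta_dist \<beta>\<^sub>1 U V / ereal M \<le> beta_dist \<beta>\<^sub>2 U V"
    unfolding beta_dist_def[of \<beta>\<^sub>2]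
  proof (rule INF_greatest)
    fix \<gamma> assume \<gamma>: "\<gamma> \<in> C1_stiefel_curves U V"
    have "beta_dist \<beta>\<^sub>1 U V \<le> ereal (beta_length \<beta>\<^sub>1 \<gamma>)"
      unfolding beta_dist_def using \<gamma> by (rule INF_lower)
    also have "\<dots> \<le> ereal M * ereal (beta_length \<beta>\<^sub>2 \<gamma>)"
      using beta_length_le[OF \<gamma> assms] by (simp add: M_def[symmetric])
    finally show "beta_dist \<beta>\<^sub>1 U V / ereal M \<le> ereal (beta_length \<beta>\<^sub>2 \<gamma>)"
      using M by (simp add: ereal_divide_le_pos)
  qed
  then show ?thesis
    using M by (simp add: ereal_divide_le_pos flip: M_def)
qed

theorem corollary3p3:
  fixes U V :: "real^'p^'n" and \<beta>\<^sub>1 \<beta>\<^sub>2 :: real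
  assumes "CARD('p) \<le> CARD('n)"
    and "\<beta>\<^sub>1 > 0" and "\<beta>\<^sub>2 > 0"
    and "U \<in> stiefel" and "V \<in> stiefel"
  shows "ereal (min 1 (sqrt (\<beta>\<^sub>1 / \<beta>\<^sub>2))) * beta_dist \<beta>\<^sub>2 U V \<le> beta_dist \<beta>\<^sub>1 U V \<and>
         beta_dist \<beta>\<^sub>1 U V \<le> ereal (max 1 (sqrt (\<beta>\<^sub>1 / \<beta>\<^sub>2))) * beta_dist \<beta>\<^sub>2 U V"
proof
  let ?m = "min 1 (sqrt (\<beta>\<^sub>1 / \<beta>\<^sub>2))" and ?M = "max 1 (sqrt (\<beta>\<^sub>2 / \<beta>\<^sub>1))"
  \<comment> \<open>The two square roots are reciprocal, hence so are the minimum and the maximum.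
    The lower bound is thus the upper bound with the parameters exchanged, multiplied by
    \<open>?m\<close>.\<close>
  have mM: "?m * ?M = 1"
    using assms by (auto simp: min_def max_def real_sqrt_divide field_simps)
  have "ereal ?m * beta_dist \<beta>\<^sub>2 U V \<le> ereal ?m * (ereal ?M * beta_dist \<beta>\<^sub>1 U V)"
    using assms by (intro ereal_mult_left_mono beta_dist_le) auto
  \<comment> \<open>The real factors are multiplied together first, so the equation holds for an
    infinite distance as well.\<close>
  also have "\<dots> = beta_dist \<beta>\<^sub>1 U V"
    by (simp only: mM times_ereal.simps flip: mult.assoc one_ereal_def) simp
  finally show "ereal ?m * beta_dist \<beta>\<^sub>2 U V \<le> beta_dist \<beta>\<^sub>1 U V" .
  show "beta_dist \<beta>\<^sub>1 U V \<le> ereal (max 1 (sqrt (\<beta>\<^sub>1 / \<beta>\<^sub>2))) * beta_dist \<beta>\<^sub>2 U V"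
    using assms by (intro beta_dist_le)
qed

end
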